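(* Let $(\Omega,\mu)$, $(S,\nu)$, $(S',\nu')$ be measure spaces, let $A(u): S\to S'$ ($u\in\Omega$) be a family of mappings, and let $\Phi$ be a $\mu\otimes\nu$-measurable function on $\Omega\times S$. Let $\infty>q\ge p\ge 1$, or $\infty=q>p\ge 1$, or $q=p=\infty$. Suppose the measure $\nu$ is sigma-finite and the family $(A(u))_{u\in\Omega}$ agrees with $\nu$ and $\nu'$ in a weak form, with associated positive $\mu$-measurable function $m$ on $\Omega$. If $$\|\Phi\|_{\mu,\nu,m}^{(p,q)}<\infty,$$ then the Hausdorff-type operator $$(\mathcal{H}_{\Phi,A,\mu}f)(x)=\int_{\Omega}\Phi(u,x)f(A(u)(x))\,d\mu(u),\quad x\in S,$$ is bounded as an operator from $L^q(\nu')$ to $L^p(\nu)$, and its norm does not exceed $\|\Phi\|_{\mu,\nu,m}^{(p,q)}$.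
   Context: Functions are complex-valued. $(\Omega,\mu)$, $(S,\nu)$, $(S',\nu')$ are three measure spaces; the mappings $A(u): S\to S'$ are not assumed invertible. Hausdorff-type operator with a two-variable kernel: for a given function $\Phi(u,x)$ on $\Omega\times S$ that is $\mu$-measurable in $u$ for every fixed $x\in S$, the operator acts on functions $f: S'\to\mathbb{C}$ by $(\mathcal{H}_{\Phi,A,\mu}f)(x)=\int_{\Omega}\Phi(u,x)f(A(u)(x))\,d\mu(u)$, $x\in S$, provided the integral converges in a suitable sense. Definition. The family $A(u): S\to S'$ ($u\in \Omega$) \emph{agrees with the measures $\nu$ and $\nu'$ in a weak form} if for each $\nu'$-measurable set $E\subset S'$ of finite measure and for every $u\in\Omega$ the set $A(u)^{-1}(E)$ is $\nu$-measurable and $\nu(A(u)^{-1}(E))\le m(u)^{-1}\nu'(E)$ for some positive $\mu$-measurable function $m$ on $\Omega$ (the same $m$ for all $E$ and $u$). Mixed norms. For a $\mu\otimes\nu$-measurable $\Phi$ on $\Omega\times S$: - for $1\le p\le q<\infty$: $\|\Phi\|_{\mu,\nu,m}^{(p,q)}:=\int_\Omega\|\Phi(u,\cdot)\|_{L^{pr}(\nu)}\,m(u)^{-1/q}\,d\mu(u)$, where $r=r(p,q)=\frac{q}{q-p}$ if $p\ne q$ and $r=\infty$ if $p=q$ (so for $p=q$ the inner norm is the $L^\infty(\nu)$ norm); - for $1\le p<\infty$, $q=\infty$: $\|\Phi\|_{\mu,\nu,m}^{(p,\infty)}:=\int_\Omega\|\Phi(u,\cdot)\|_{L^{p}(\nu)}\,d\mu(u)$;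 - for $p=q=\infty$: $\|\Phi\|_{\mu,\nu,m}^{(\infty,\infty)}:=\operatorname{ess\,sup}_{x\in S}\int_\Omega|\Phi(u,x)|\,d\mu(u)$.
   Formalization: Added, since the claim fails without them: Φ(u,x)f(A(u)(x)) is μ⊗ν-measurable (product sigma-algebra) for every f in L^q(ν'), and Φ vanishes outside Ω₀×S for some measurable Ω₀ on which μ is sigma-finite (automatic if μ is sigma-finite). *)

theory Defs
  imports "HOL-Analysis.Analysis" "HOL-Probability.Essential_Supremum"
begin

definition eLp_norm :: "ennreal \<Rightarrow> 'a measure \<Rightarrow> ('a \<Rightarrow> complex) \<Rightarrow> ennreal" where
  "eLp_norm p M f =
    (if p = \<infinity> then esssup M (\<lambda>x. ennreal (norm (f x)))
     else let I = (\<integral>\<^sup>+x. ennreal (norm (f x) powr enn2real p) \<partial>M)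
          in if I = \<infinity> then \<infinity> else ennreal (enn2real I powr (1 / enn2real p)))"

text \<open>Elements of \<open>Lp_fun p M\<close> are functions, not classes modulo a.e. equality.\<close>

definition Lp_fun :: "ennreal \<Rightarrow> 'a measure \<Rightarrow> ('a \<Rightarrow> complex) set" where
  "Lp_fun p M = {f. f \<in> borel_measurable M \<and> eLp_norm p M f < \<infinity>}"

text \<open>A map on functions induces a bounded linear operator between the quotient spaces
  \<open>L\<^sup>q(M)\<close> and \<open>L\<^sup>p(N)\<close>.\<close>

definition bounded_Lp_operator ::
  "ennreal \<Rightarrow> 'a measure \<Rightarrow> ennreal \<Rightarrow> 'b measure \<Rightarrow> (('a \<Rightarrow> complex) \<Rightarrow> ('b \<Rightarrow> complex)) \<Rightarrow> bool" where
  "bounded_Lp_operator q M p N T \<longleftrightarrow>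
     (\<forall>f\<in>Lp_fun q M. T f \<in> Lp_fun p N) \<and>
     (\<forall>f\<in>Lp_fun q M. \<forall>g\<in>Lp_fun q M. (AE x in M. f x = g x) \<longrightarrow> (AE y in N. T f y = T g y)) \<and>
     (\<forall>f\<in>Lp_fun q M. \<forall>g\<in>Lp_fun q M. AE y in N. T (\<lambda>x. f x + g x) y = T f y + T g y) \<and>
     (\<forall>f\<in>Lp_fun q M. \<forall>c. AE y in N. T (\<lambda>x. c * f x) y = c * T f y) \<and>
     (\<exists>C<\<infinity>. \<forall>f\<in>Lp_fun q M. eLp_norm p N (T f) \<le> C * eLp_norm q M f)"

definition Lp_operator_norm ::
  "ennreal \<Rightarrow> 'a measure \<Rightarrow> ennreal \<Rightarrow> 'b measure \<Rightarrow> (('a \<Rightarrow> complex) \<Rightarrow> ('b \<Rightarrow> complex)) \<Rightarrow> ennreal" where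
  "Lp_operator_norm q M p N T = (SUP f\<in>{f \<in> Lp_fun q M. eLp_norm q M f \<le> 1}. eLp_norm p N (T f))"

definition hausdorff_op ::
  "('u \<Rightarrow> 's \<Rightarrow> complex) \<Rightarrow> ('u \<Rightarrow> 's \<Rightarrow> 't) \<Rightarrow> 'u measure \<Rightarrow> ('t \<Rightarrow> complex) \<Rightarrow> 's \<Rightarrow> complex" where
  "hausdorff_op \<Phi> A M f x = (\<integral>u. \<Phi> u x * f (A u x) \<partial>M)"

definition agrees_weakly ::
  "'u measure \<Rightarrow> 's measure \<Rightarrow> 't measure \<Rightarrow> ('u \<Rightarrow> 's \<Rightarrow> 't) \<Rightarrow> ('u \<Rightarrow> real) \<Rightarrow> bool" where
  "agrees_weakly M N N' A m \<longleftrightarrow>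
     m \<in> borel_measurable M \<and> (\<forall>u\<in>space M. 0 < m u) \<and>
     (\<forall>u\<in>space M. \<forall>E\<in>sets N'. emeasure N' E < \<infinity> \<longrightarrow>
        A u -` E \<inter> space N \<in> sets N \<and>
        emeasure N (A u -` E \<inter> space N) \<le> ennreal (inverse (m u)) * emeasure N' E)"

definition mixed_exponent :: "ennreal \<Rightarrow> ennreal \<Rightarrow> ennreal" where
  "mixed_exponent p q = (if p = q then \<infinity> else q / (q - p))"

definition mixed_norm ::
  "ennreal \<Rightarrow> ennreal \<Rightarrow> 'u measure \<Rightarrow> 's measure \<Rightarrow> ('u \<Rightarrow> real) \<Rightarrow> ('u \<Rightarrow> 's \<Rightarrow> complex) \<Rightarrow> ennreal" where
  "mixed_norm p q M N m \<Phi> =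
    (if q < \<infinity> then
       (\<integral>\<^sup>+u. eLp_norm (p * mixed_exponent p q) N (\<Phi> u) * ennreal (m u powr (- 1 / enn2real q)) \<partial>M)
     else if p < \<infinity> then (\<integral>\<^sup>+u. eLp_norm p N (\<Phi> u) \<partial>M)
     else esssup N (\<lambda>x. \<integral>\<^sup>+u. ennreal (norm (\<Phi> u x)) \<partial>M))"

end

theory Submission
  imports Defs
begin

text \<open>For finite \<open>p\<close>, Minkowski's integral inequality bounds the \<open>L\<^sup>p\<close> norm of
  \<open>x \<mapsto> \<integral> |\<Phi>(u, x) f(A(u)(x))| d\<mu>(u)\<close> by the integral over \<open>u\<close> of the \<open>L\<^sup>p\<close> norms of the slices.
  Hoelder's inequality with exponents \<open>pr\<close> and \<open>q\<close> splits each slice, and the weak agreement gives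
  \<open>\<parallel>f \<circ> A(u)\<parallel>\<^sub>q \<le> m(u)\<^bsup>-1/q\<^esup> \<parallel>f\<parallel>\<^sub>q\<close>. For \<open>q = \<infinity>\<close> it suffices that preimages of null sets are null.
  All estimates are made in \<open>[0, \<infinity>]\<close>, so that almost everywhere convergence of the integral is a
  consequence of the bound.\<close>

section \<open>Real powers on [0, \<infinity>]\<close>

text \<open>0 and \<open>\<infinity>\<close> are fixed points for every exponent, also for zero and
  negative ones. With this convention the laws for products, sums of exponents and iterated powers
  hold for all real exponents without side conditions.\<close>

definition ennreal_powr :: "ennreal \<Rightarrow> real \<Rightarrow> ennreal" where
  "ennreal_powr x a = (if x = \<infinity> then \<infinity> else ennreal (enn2real x powr a))"

lemma ennreal_powr_infinity [simp]: "ennreal_powr \<infinity> a = \<infinity>" "ennreal_powr top a = top"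
  by (simp_all add: ennreal_powr_def)

lemma ennreal_powr_ennreal [simp]: "0 \<le> x \<Longrightarrow> ennreal_powr (ennreal x) a = ennreal (x powr a)"
  by (simp add: ennreal_powr_def)

lemma ennreal_powr_0 [simp]: "ennreal_powr 0 a = 0"
  by (simp add: ennreal_powr_def)

lemma ennreal_powr_1 [simp]: "ennreal_powr 1 a = 1"
  by (simp add: ennreal_powr_def)

lemma ennreal_powr_one [simp]: "ennreal_powr x 1 = x"
  by (cases x) simp_all

lemma ennreal_powr_eq_top [simp]: "ennreal_powr x a = top \<longleftrightarrow> x = top"
  by (simp add: ennreal_powr_def)

lemma ennreal_powr_less_top [simp]: "ennreal_powr x a < top \<longleftrightarrow> x < top"
  by (simp add: less_top[symmetric])

lemma ennreal_powr_eq_0 [simp]: "ennreal_powr x a = 0 \<longleftrightarrow> x = 0"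
  by (cases x) (auto simp: ennreal_eq_0_iff)

lemma ennreal_powr_mono:
  assumes "x \<le> y" "0 \<le> a"
  shows "ennreal_powr x a \<le> ennreal_powr y a"
  using assms by (cases x; cases y) (auto intro!: ennreal_leI powr_mono2 simp: top_unique)

lemma ennreal_powr_mult: "ennreal_powr (x * y) a = ennreal_powr x a * ennreal_powr y a"
proof (cases "x = 0 \<or> y = 0")
  case False
  then have *: "ennreal_powr x a \<noteq> 0" "ennreal_powr y a \<noteq> 0" "x \<noteq> 0" "y \<noteq> 0" by auto
  show ?thesis
  proof (cases "x = top \<or> y = top")
    case True
    then show ?thesis using * by (auto simp: ennreal_mult_top ennreal_top_mult)
  next
    case False
    then show ?thesis
      by (cases x; cases y) (simp_all flip: ennreal_mult add: powr_mult)
  qed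
qed auto

lemma ennreal_powr_powr: "ennreal_powr (ennreal_powr x a) b = ennreal_powr x (a * b)"
  by (cases x) (simp_all add: powr_powr)

lemma ennreal_powr_add: "ennreal_powr x a * ennreal_powr x b = ennreal_powr x (a + b)"
  by (cases x) (simp_all add: powr_add ennreal_mult)

lemma ennreal_powr_inverse_cancel:
  "a \<noteq> 0 \<Longrightarrow> ennreal_powr (ennreal_powr x (1 / a)) a = x"
  "a \<noteq> 0 \<Longrightarrow> ennreal_powr (ennreal_powr x a) (1 / a) = x"
  by (simp_all add: ennreal_powr_powr)

lemma measurable_ennreal_powr [measurable]:
  assumes [measurable]: "f \<in> borel_measurable M"
  shows "(\<lambda>x. ennreal_powr (f x) a) \<in> borel_measurable M"
  unfolding ennreal_powr_def infinity_ennreal_def by measurable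

lemma ennreal_mult_inverse_self:
  fixes x :: ennreal
  shows "x \<noteq> 0 \<Longrightarrow> x \<noteq> top \<Longrightarrow> x * inverse x = 1"
  using ennreal_divide_self[of x] by (simp add: divide_ennreal_def less_top)

lemma ennreal_powr_measurable_iff:
  assumes "a \<noteq> 0"
  shows "(\<lambda>x. ennreal_powr (f x) a) \<in> borel_measurable M \<longleftrightarrow> f \<in> borel_measurable M"
proof
  assume "(\<lambda>x. ennreal_powr (f x) a) \<in> borel_measurable M"
  from measurable_ennreal_powr[OF this, of "1/a"] show "f \<in> borel_measurable M"
    using assms by (simp add: ennreal_powr_inverse_cancel)
qed measurable

section \<open>The inequalities of Young, Hoelder and Minkowski for [0, \<infinity>]-valued
  functions\<close>

lemma ennreal_Young:
  assumes "a > 1" "b > 1" "1/a + 1/b = 1"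
  shows "x * y \<le> ennreal_powr x a * ennreal (1/a) + ennreal_powr y b * ennreal (1/b)"
proof (cases "x = top \<or> y = top")
  case True
  then have "ennreal_powr x a * ennreal (1/a) + ennreal_powr y b * ennreal (1/b) = top"
    using assms by (auto simp: ennreal_top_mult)
  then show ?thesis by (simp only: top_greatest)
next
  case False
  then obtain r s where "x = ennreal r" "r \<ge> 0" "y = ennreal s" "s \<ge> 0"
    by (cases x; cases y) auto
  with Youngs_inequality[OF assms, of r s] show ?thesis using assms
    by (simp flip: ennreal_mult ennreal_plus add: ennreal_leI)
qed

text \<open>Scaling both factors to norm 1 and integrating Young's inequality leaves 1/a + 1/b = 1.
  Norms equal to 0 or \<open>\<infinity>\<close> are treated apart, since the scaling divides by
  them.\<close>

lemma nn_integral_Hoelder: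
  assumes ab: "a > 1" "b > 1" "1/a + 1/b = 1"
    and [measurable]: "f \<in> borel_measurable M" "g \<in> borel_measurable M"
  shows "(\<integral>\<^sup>+x. f x * g x \<partial>M) \<le>
    ennreal_powr (\<integral>\<^sup>+x. ennreal_powr (f x) a \<partial>M) (1/a) *
    ennreal_powr (\<integral>\<^sup>+x. ennreal_powr (g x) b \<partial>M) (1/b)"
proof -
  define I where "I = (\<integral>\<^sup>+x. ennreal_powr (f x) a \<partial>M)"
  define J where "J = (\<integral>\<^sup>+x. ennreal_powr (g x) b \<partial>M)"
  define \<alpha> where "\<alpha> = ennreal_powr I (1/a)"
  define \<beta> where "\<beta> = ennreal_powr J (1/b)"
  \<comment> \<open>Vanishing norms come first: as 0 * \<open>\<infinity>\<close> = 0, an infinite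
    norm makes the right-hand side infinite only if the other norm is nonzero.\<close>
  consider "I = 0 \<or> J = 0" | "I \<noteq> 0" "J \<noteq> 0" "I = top \<or> J = top"
    | "I \<noteq> 0" "J \<noteq> 0" "I \<noteq> top" "J \<noteq> top" by blast
  then have "(\<integral>\<^sup>+x. f x * g x \<partial>M) \<le> \<alpha> * \<beta>"
  proof cases
    case 1
    then have "(AE x in M. ennreal_powr (f x) a = 0) \<or> (AE x in M. ennreal_powr (g x) b = 0)"
      unfolding I_def J_def by (subst (asm) (1 2) nn_integral_0_iff_AE) auto
    then have "AE x in M. f x * g x = 0"
      by (auto elim!: eventually_mono)
    then have "(\<integral>\<^sup>+x. f x * g x \<partial>M) = (\<integral>\<^sup>+x. 0 \<partial>M)" by (rule nn_integral_cong_AE)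
    then show ?thesis by simp
  next
    case 2
    then have "\<alpha> * \<beta> = top" unfolding \<alpha>_def \<beta>_def
      by (auto simp: ennreal_mult_eq_top_iff)
    then show ?thesis by simp
  next
    case 3
    then have fin: "\<alpha> \<noteq> 0" "\<beta> \<noteq> 0" "\<alpha> \<noteq> top" "\<beta> \<noteq> top" by (simp_all add: \<alpha>_def \<beta>_def)
    then have inv: "\<alpha> * inverse \<alpha> = 1" "\<beta> * inverse \<beta> = 1"
      by (simp_all add: ennreal_mult_inverse_self)
    have I: "ennreal_powr \<alpha> a = I" and J: "ennreal_powr \<beta> b = J"
      unfolding \<alpha>_def \<beta>_def using ab by (simp_all add: ennreal_powr_inverse_cancel)
    have "(\<integral>\<^sup>+x. f x * g x \<partial>M) = (\<integral>\<^sup>+x. (\<alpha> * \<beta>) * ((inverse \<alpha> * f x) * (inverse \<beta> * g x)) \<partial>M)"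
    proof (rule nn_integral_cong)
      fix x
      have "(\<alpha> * \<beta>) * ((inverse \<alpha> * f x) * (inverse \<beta> * g x))
        = (\<alpha> * inverse \<alpha>) * (\<beta> * inverse \<beta>) * (f x * g x)" by (simp only: ac_simps)
      then show "f x * g x = (\<alpha> * \<beta>) * ((inverse \<alpha> * f x) * (inverse \<beta> * g x))"
        by (simp add: inv)
    qed
    also have "\<dots> = (\<alpha> * \<beta>) * (\<integral>\<^sup>+x. (inverse \<alpha> * f x) * (inverse \<beta> * g x) \<partial>M)"
      by (intro nn_integral_cmult) measurable
    also have "\<dots> \<le> (\<alpha> * \<beta>) * (\<integral>\<^sup>+x. ennreal_powr (inverse \<alpha> * f x) a * ennreal (1/a)
        + ennreal_powr (inverse \<beta> * g x) b * ennreal (1/b) \<partial>M)"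
      by (intro mult_left_mono nn_integral_mono ennreal_Young ab) simp
    also have "(\<integral>\<^sup>+x. ennreal_powr (inverse \<alpha> * f x) a * ennreal (1/a)
        + ennreal_powr (inverse \<beta> * g x) b * ennreal (1/b) \<partial>M)
        = ennreal_powr (inverse \<alpha>) a * I * ennreal (1/a) + ennreal_powr (inverse \<beta>) b * J * ennreal (1/b)"
      unfolding I_def J_def ennreal_powr_mult
      by (simp add: nn_integral_add nn_integral_multc nn_integral_cmult)
    also have "\<dots> = ennreal_powr (\<alpha> * inverse \<alpha>) a * ennreal (1/a)
        + ennreal_powr (\<beta> * inverse \<beta>) b * ennreal (1/b)"
      by (simp only: ennreal_powr_mult I J ac_simps)
    also have "\<dots> = 1" unfolding inv using ab by (simp flip: ennreal_plus)
    finally show ?thesis by simp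
  qed
  then show ?thesis by (simp add: \<alpha>_def \<beta>_def I_def J_def)
qed

text \<open>Hoelder's inequality is applied to \<open>t u x = F u x / c u\<close> under the weight \<open>c u = \<parallel>F u\<parallel>\<^sub>p\<close>; since
  each \<open>t u\<close> has \<open>L\<^sup>p\<close> norm at most 1, no truncation argument is needed to divide by a norm.\<close>

lemma (in pair_sigma_finite) nn_integral_Minkowski:
  fixes F :: "'a \<Rightarrow> 'b \<Rightarrow> ennreal"
  assumes p: "1 \<le> p"
    and [measurable]: "(\<lambda>(u, x). F u x) \<in> borel_measurable (M1 \<Otimes>\<^sub>M M2)"
  shows "ennreal_powr (\<integral>\<^sup>+x. ennreal_powr (\<integral>\<^sup>+u. F u x \<partial>M1) p \<partial>M2) (1/p)
    \<le> (\<integral>\<^sup>+u. ennreal_powr (\<integral>\<^sup>+x. ennreal_powr (F u x) p \<partial>M2) (1/p) \<partial>M1)"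
proof (cases "p = 1")
  case True
  then show ?thesis using Fubini'[of F] by simp
next
  case False
  with p have p: "1 < p" by simp
  \<comment> \<open>The exponent conjugate to \<open>p\<close>. The identity
    \<open>p / b = p - 1\<close> gives the power of \<open>C\<close> that remains after raising
    Hoelder's bound to the power \<open>p\<close>.\<close>
  define b where "b = p / (p - 1)"
  have b: "1 < b" "1/p + 1/b = 1" "p / b = p - 1"
    using p by (simp_all add: b_def field_simps)
  have [measurable]: "(\<lambda>(x, u). F u x) \<in> borel_measurable (M2 \<Otimes>\<^sub>M M1)"
    by (subst measurable_pair_swap_iff) simp
  define c where "c u = ennreal_powr (\<integral>\<^sup>+x. ennreal_powr (F u x) p \<partial>M2) (1/p)" for u
  define C where "C = (\<integral>\<^sup>+u. c u \<partial>M1)"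
  define t where "t u x = F u x * inverse (c u)" for u x
  have [measurable]: "c \<in> borel_measurable M1"
    unfolding c_def by measurable
  have t_meas [measurable]: "(\<lambda>(u, x). t u x) \<in> borel_measurable (M1 \<Otimes>\<^sub>M M2)"
    "(\<lambda>(x, u). t u x) \<in> borel_measurable (M2 \<Otimes>\<^sub>M M1)"
    unfolding t_def by measurable
  have cp: "ennreal_powr (c u) p = (\<integral>\<^sup>+x. ennreal_powr (F u x) p \<partial>M2)" for u
    unfolding c_def using p by (simp add: ennreal_powr_inverse_cancel)
  show ?thesis
  proof (cases "C = top")
    case True
    then show ?thesis by (simp add: C_def c_def)
  next
    case False
    have fin: "AE u in M1. c u \<noteq> top"
      using False unfolding C_def by (intro nn_integral_noteq_infinite[unfolded infinity_ennreal_def]) simp_all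
    \<comment> \<open>The factorisation \<open>F u x = t u x * c u\<close> is delicate at
      \<open>c u = 0\<close>, where \<open>inverse (c u)\<close> is infinite; there
      \<open>F u\<close> vanishes almost everywhere. The exceptional set in \<open>x\<close> depends
      on \<open>u\<close>, so Fubini for null sets is needed to get, for almost every
      \<open>x\<close>, a statement about almost all \<open>u\<close>.\<close>
    have "AE u in M1. AE x in M2. c u = 0 \<longrightarrow> F u x = 0"
    proof (rule AE_I2)
      fix u assume [measurable]: "u \<in> space M1"
      show "AE x in M2. c u = 0 \<longrightarrow> F u x = 0"
      proof (cases "c u = 0")
        case True
        then have "(\<integral>\<^sup>+x. ennreal_powr (F u x) p \<partial>M2) = 0" by (simp add: cp[symmetric])
        then show ?thesis by (subst (asm) nn_integral_0_iff_AE) auto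
      qed simp
    qed
    then have zero: "AE x in M2. AE u in M1. c u = 0 \<longrightarrow> F u x = 0"
      by (subst (asm) AE_commute) measurable
    have "AE x in M2. ennreal_powr (\<integral>\<^sup>+u. F u x \<partial>M1) p
        \<le> (\<integral>\<^sup>+u. ennreal_powr (t u x) p * c u \<partial>M1) * ennreal_powr C (p - 1)"
      using zero AE_space
    proof eventually_elim
      case (elim x)
      note [measurable] = elim(2)
      have "AE u in M1. F u x = t u x * c u"
        using elim(1) fin
      proof eventually_elim
        case (elim u)
        show ?case
        proof (cases "c u = 0")
          case False
          then have "inverse (c u) * c u = 1" using elim
            by (subst mult.commute) (simp add: ennreal_mult_inverse_self)
          then show ?thesis by (simp add: t_def mult.assoc)
        qed (use elim in simp)
      qed
      then have "(\<integral>\<^sup>+u. F u x \<partial>M1) = (\<integral>\<^sup>+u. t u x * c u \<partial>M1)" by (rule nn_integral_cong_AE)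
      \<comment> \<open>The weight splits as \<open>c u\<close> = (\<open>c u\<close>)^(1/p) *
        (\<open>c u\<close>)^(1/b), so that the second Hoelder factor integrates to a power of
        \<open>C\<close>.\<close>
      also have "\<dots> = (\<integral>\<^sup>+u. (t u x * ennreal_powr (c u) (1/p)) * ennreal_powr (c u) (1/b) \<partial>M1)"
        by (simp add: mult.assoc ennreal_powr_add b)
      also have "\<dots> \<le> ennreal_powr (\<integral>\<^sup>+u. ennreal_powr (t u x * ennreal_powr (c u) (1/p)) p \<partial>M1) (1/p) *
          ennreal_powr (\<integral>\<^sup>+u. ennreal_powr (ennreal_powr (c u) (1/b)) b \<partial>M1) (1/b)"
        by (intro nn_integral_Hoelder p b) measurable
      also have "\<dots> = ennreal_powr (\<integral>\<^sup>+u. ennreal_powr (t u x) p * c u \<partial>M1) (1/p) * ennreal_powr C (1/b)"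
        using p b unfolding C_def by (simp add: ennreal_powr_mult ennreal_powr_inverse_cancel)
      finally have "ennreal_powr (\<integral>\<^sup>+u. F u x \<partial>M1) p
        \<le> ennreal_powr (ennreal_powr (\<integral>\<^sup>+u. ennreal_powr (t u x) p * c u \<partial>M1) (1/p) * ennreal_powr C (1/b)) p"
        using p by (intro ennreal_powr_mono) auto
      also have "\<dots> = (\<integral>\<^sup>+u. ennreal_powr (t u x) p * c u \<partial>M1) * ennreal_powr C (p - 1)"
        using p b(3) by (simp add: ennreal_powr_mult ennreal_powr_powr)
      finally show ?case .
    qed
    then have "(\<integral>\<^sup>+x. ennreal_powr (\<integral>\<^sup>+u. F u x \<partial>M1) p \<partial>M2)
      \<le> (\<integral>\<^sup>+x. (\<integral>\<^sup>+u. ennreal_powr (t u x) p * c u \<partial>M1) * ennreal_powr C (p - 1) \<partial>M2)"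
      by (rule nn_integral_mono_AE)
    also have "\<dots> = (\<integral>\<^sup>+x. \<integral>\<^sup>+u. ennreal_powr (t u x) p * c u \<partial>M1 \<partial>M2) * ennreal_powr C (p - 1)"
      by (intro nn_integral_multc) measurable
    also have "(\<integral>\<^sup>+x. \<integral>\<^sup>+u. ennreal_powr (t u x) p * c u \<partial>M1 \<partial>M2)
      = (\<integral>\<^sup>+u. \<integral>\<^sup>+x. ennreal_powr (t u x) p * c u \<partial>M2 \<partial>M1)"
      by (intro Fubini') measurable
    also have "\<dots> \<le> C"
      unfolding C_def
    proof (rule nn_integral_mono)
      fix u assume [measurable]: "u \<in> space M1"
      have "(\<integral>\<^sup>+x. ennreal_powr (t u x) p * c u \<partial>M2)
        = (\<integral>\<^sup>+x. ennreal_powr (F u x) p * (ennreal_powr (inverse (c u)) p * c u) \<partial>M2)"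
        by (simp add: t_def ennreal_powr_mult mult.assoc)
      also have "\<dots> = ennreal_powr (c u) p * (ennreal_powr (inverse (c u)) p * c u)"
        unfolding cp by (intro nn_integral_multc) measurable
      also have "\<dots> = ennreal_powr (c u * inverse (c u)) p * c u"
        by (simp add: ennreal_powr_mult mult.assoc)
      also have "\<dots> \<le> 1 * c u"
      proof (rule mult_right_mono)
        \<comment> \<open>Only an inequality: the product is 0, not 1, when \<open>c u\<close> is 0
          or \<open>\<infinity>\<close>.\<close>
        have "c u * inverse (c u) \<le> 1"
          by (cases "c u = 0 \<or> c u = top")
            (auto simp: ennreal_mult_inverse_self)
        from ennreal_powr_mono[OF this, of p] show "ennreal_powr (c u * inverse (c u)) p \<le> 1"
          using p by simp
      qed simp
      finally show "(\<integral>\<^sup>+x. ennreal_powr (t u x) p * c u \<partial>M2) \<le> c u" by simp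
    qed
    finally have "(\<integral>\<^sup>+x. ennreal_powr (\<integral>\<^sup>+u. F u x \<partial>M1) p \<partial>M2) \<le> ennreal_powr C 1 * ennreal_powr C (p - 1)"
      by (simp add: mult_right_mono)
    also have "\<dots> = ennreal_powr C p" by (simp add: ennreal_powr_add del: ennreal_powr_one)
    finally have "ennreal_powr (\<integral>\<^sup>+x. ennreal_powr (\<integral>\<^sup>+u. F u x \<partial>M1) p \<partial>M2) (1/p)
      \<le> ennreal_powr (ennreal_powr C p) (1/p)"
      using p by (intro ennreal_powr_mono) auto
    then show ?thesis using p by (simp add: ennreal_powr_inverse_cancel C_def c_def)
  qed
qed

section \<open>Composition with a map that increases measure by at most a constant factor\<close>

text \<open>Only sets of finite measure are required to have measurable preimages, so \<open>T\<close> need not be measurable when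
  \<open>N'\<close> is not sigma-finite.\<close>

definition weakly_bounded_map :: "'s measure \<Rightarrow> 't measure \<Rightarrow> ennreal \<Rightarrow> ('s \<Rightarrow> 't) \<Rightarrow> bool" where
  "weakly_bounded_map N N' c T \<longleftrightarrow> T \<in> space N \<rightarrow> space N' \<and>
     (\<forall>E\<in>sets N'. emeasure N' E < \<infinity> \<longrightarrow>
       T -` E \<inter> space N \<in> sets N \<and> emeasure N (T -` E \<inter> space N) \<le> c * emeasure N' E)"

text \<open>A finite integral forces each level set of a nonzero value to have finite measure, so
  the preimage bound applies to it. The level set of 0 may have infinite measure, but its term
  contributes nothing.\<close>

lemma simple_function_comp_weak:
  fixes s :: "'t \<Rightarrow> ennreal"
  assumes T: "weakly_bounded_map N N' c T"
    and s: "simple_function N' s" and fin: "(\<integral>\<^sup>+y. s y \<partial>N') < \<infinity>"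
  shows "(\<lambda>x. s (T x)) \<in> borel_measurable N"
    and "(\<integral>\<^sup>+x. s (T x) \<partial>N) \<le> c * (\<integral>\<^sup>+y. s y \<partial>N')"
proof -
  define B where "B y = s -` {y} \<inter> space N'" for y
  have B [measurable]: "B y \<in> sets N'" for y
    unfolding B_def using simple_functionD(2)[OF s] .
  have finV: "finite (s ` space N')" using simple_functionD(1)[OF s] .
  have int: "(\<integral>\<^sup>+y. s y \<partial>N') = (\<Sum>y\<in>s ` space N'. y * emeasure N' (B y))"
    using s by (simp add: nn_integral_eq_simple_integral simple_integral_def B_def)
  have finB: "emeasure N' (B y) < \<infinity>" if "y \<in> s ` space N'" "y \<noteq> 0" for y
  proof -
    have "y * emeasure N' (B y) \<le> (\<Sum>y\<in>s ` space N'. y * emeasure N' (B y))"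
      using finV that by (intro member_le_sum) auto
    also have "\<dots> < \<infinity>" using fin int by simp
    finally show ?thesis using that by (auto simp: ennreal_mult_less_top)
  qed
  define D where "D y = T -` B y \<inter> space N" for y
  have D: "D y \<in> sets N" "emeasure N (D y) \<le> c * emeasure N' (B y)"
    if "y \<in> s ` space N'" "y \<noteq> 0" for y
    using T B finB[OF that] by (auto simp: D_def weakly_bounded_map_def)
  \<comment> \<open>\<open>D 0\<close> may fail to be measurable; the factor \<open>y = 0\<close>
    makes that summand constantly 0.\<close>
  have meas: "(\<lambda>x. y * indicator (D y) x) \<in> borel_measurable N" if "y \<in> s ` space N'" for y
    using D[OF that] by (cases "y = 0") auto
  have repr: "s (T x) = (\<Sum>y\<in>s ` space N'. y * indicator (D y) x)" if "x \<in> space N" for x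
  proof -
    have "T x \<in> space N'" using T that by (auto simp: weakly_bounded_map_def)
    from simple_function_indicator_representation[OF s this] that show ?thesis
      by (auto simp: D_def B_def indicator_def intro!: sum.cong)
  qed
  have "(\<lambda>x. \<Sum>y\<in>s ` space N'. y * indicator (D y) x) \<in> borel_measurable N"
    using meas by (intro borel_measurable_sum)
  then show "(\<lambda>x. s (T x)) \<in> borel_measurable N"
    by (subst measurable_cong[OF repr])
  have "(\<integral>\<^sup>+x. s (T x) \<partial>N) = (\<integral>\<^sup>+x. (\<Sum>y\<in>s ` space N'. y * indicator (D y) x) \<partial>N)"
    by (rule nn_integral_cong) (rule repr)
  also have "\<dots> = (\<Sum>y\<in>s ` space N'. \<integral>\<^sup>+x. y * indicator (D y) x \<partial>N)"
    using meas by (rule nn_integral_sum)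
  also have "\<dots> \<le> (\<Sum>y\<in>s ` space N'. c * (y * emeasure N' (B y)))"
  proof (rule sum_mono)
    fix y assume y: "y \<in> s ` space N'"
    show "(\<integral>\<^sup>+x. y * indicator (D y) x \<partial>N) \<le> c * (y * emeasure N' (B y))"
    proof (cases "y = 0")
      case False
      then have "(\<integral>\<^sup>+x. y * indicator (D y) x \<partial>N) = y * emeasure N (D y)"
        using D y by (simp add: nn_integral_cmult_indicator)
      also have "\<dots> \<le> y * (c * emeasure N' (B y))" using D y False by (intro mult_left_mono) auto
      finally show ?thesis by (simp add: ac_simps)
    qed simp
  qed
  also have "\<dots> = c * (\<integral>\<^sup>+y. s y \<partial>N')" unfolding int by (simp add: sum_distrib_left)
  finally show "(\<integral>\<^sup>+x. s (T x) \<partial>N) \<le> c * (\<integral>\<^sup>+y. s y \<partial>N')" .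
qed

text \<open>Simple functions increasing to \<open>g\<close> inherit the finite integral, so the
  preceding lemma applies to each of them, and monotone convergence passes to the limit.
  Measurability of the composition is part of the conclusion, because it cannot be obtained from
  \<open>T\<close> being measurable.\<close>

lemma nn_integral_comp_weak:
  fixes g :: "'t \<Rightarrow> ennreal"
  assumes T: "weakly_bounded_map N N' c T"
    and g: "g \<in> borel_measurable N'" and fin: "(\<integral>\<^sup>+y. g y \<partial>N') < \<infinity>"
  shows "(\<lambda>x. g (T x)) \<in> borel_measurable N"
    and "(\<integral>\<^sup>+x. g (T x) \<partial>N) \<le> c * (\<integral>\<^sup>+y. g y \<partial>N')"
proof -
  obtain s where s: "\<And>i. simple_function N' (s i)" "incseq s" "\<And>i y. s i y < top"
      and sup: "\<And>y. (SUP i. s i y) = g y"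
    using borel_measurable_implies_simple_function_sequence'[OF g] by blast
  have le: "s i y \<le> g y" for i y unfolding sup[symmetric] by (rule SUP_upper) simp
  have int_le: "(\<integral>\<^sup>+y. s i y \<partial>N') \<le> (\<integral>\<^sup>+y. g y \<partial>N')" for i
    by (intro nn_integral_mono le)
  then have "(\<integral>\<^sup>+y. s i y \<partial>N') < \<infinity>" for i using fin le_less_trans by blast
  note s_comp = simple_function_comp_weak[OF T s(1) this]
  have "(\<lambda>x. SUP i. s i (T x)) \<in> borel_measurable N"
    using s_comp(1) by (intro borel_measurable_SUP) auto
  then show "(\<lambda>x. g (T x)) \<in> borel_measurable N" by (simp add: sup)
  have "(\<integral>\<^sup>+x. g (T x) \<partial>N) = (\<integral>\<^sup>+x. (SUP i. s i (T x)) \<partial>N)" by (simp add: sup)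
  also have "\<dots> = (SUP i. \<integral>\<^sup>+x. s i (T x) \<partial>N)"
    using s_comp(1) s(2) by (intro nn_integral_monotone_convergence_SUP) (auto simp: incseq_def le_fun_def)
  also have "\<dots> \<le> c * (\<integral>\<^sup>+y. g y \<partial>N')"
    using s_comp(2) int_le by (intro SUP_least) (meson mult_left_mono order_trans zero_le)
  finally show "(\<integral>\<^sup>+x. g (T x) \<partial>N) \<le> c * (\<integral>\<^sup>+y. g y \<partial>N')" .
qed

text \<open>An exceptional null set has finite measure, so its preimage is measurable and of measure
  at most \<open>c * 0 = 0\<close>, even for \<open>c = \<infinity>\<close>.\<close>

lemma AE_comp_weak:
  assumes T: "weakly_bounded_map N N' c T"
    and AE: "AE y in N'. P y"
  shows "AE x in N. P (T x)"
proof -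
  from AE obtain E where E: "{y \<in> space N'. \<not> P y} \<subseteq> E" "emeasure N' E = 0" "E \<in> sets N'"
    by (rule AE_E)
  show ?thesis
  proof (rule AE_I)
    show "{x \<in> space N. \<not> P (T x)} \<subseteq> T -` E \<inter> space N" using E T by (auto simp: weakly_bounded_map_def)
    show "emeasure N (T -` E \<inter> space N) = 0" "T -` E \<inter> space N \<in> sets N"
      using T E by (auto simp: weakly_bounded_map_def)
  qed
qed

section \<open>Norms and Hoelder's inequality in \<open>L^p\<close> for [0, \<infinity>]-valued
  functions\<close>

text \<open>Extends \<open>eLp_norm\<close> to functions with infinite values, such as an integral
  of moduli whose convergence is still open.\<close>

definition nn_Lp_norm :: "ennreal \<Rightarrow> 'a measure \<Rightarrow> ('a \<Rightarrow> ennreal) \<Rightarrow> ennreal" where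
  "nn_Lp_norm p M g =
    (if p = \<infinity> then esssup M g
     else ennreal_powr (\<integral>\<^sup>+x. ennreal_powr (g x) (enn2real p) \<partial>M) (1 / enn2real p))"

lemma eLp_norm_eq: "eLp_norm p M f = nn_Lp_norm p M (\<lambda>x. ennreal (norm (f x)))"
  by (simp add: eLp_norm_def nn_Lp_norm_def ennreal_powr_def Let_def)

lemma nn_Lp_norm_ennreal:
  "0 \<le> r \<Longrightarrow> nn_Lp_norm (ennreal r) M g = ennreal_powr (\<integral>\<^sup>+x. ennreal_powr (g x) r \<partial>M) (1 / r)"
  by (simp add: nn_Lp_norm_def)

lemma nn_Lp_norm_top: "nn_Lp_norm top M g = esssup M g"
  by (simp add: nn_Lp_norm_def)

lemma exponent_ge_1_cases:
  fixes p :: ennreal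
  assumes "1 \<le> p"
  obtains "p = \<infinity>" | r where "p = ennreal r" "1 \<le> r"
  using assms by (cases p) auto

lemma nn_Lp_norm_mono_AE:
  assumes "g \<in> borel_measurable M" "AE x in M. g x \<le> h x"
  shows "nn_Lp_norm p M g \<le> nn_Lp_norm p M h"
proof (cases "p = \<infinity>")
  case True
  then show ?thesis using esssup_AE_mono[OF assms] by (simp add: nn_Lp_norm_def)
next
  case False
  have "AE x in M. ennreal_powr (g x) (enn2real p) \<le> ennreal_powr (h x) (enn2real p)"
    using assms(2) by eventually_elim (rule ennreal_powr_mono, auto)
  then show ?thesis using False
    by (auto simp: nn_Lp_norm_def intro!: ennreal_powr_mono nn_integral_mono_AE)
qed

lemma nn_Lp_norm_cong_AE:
  assumes "g \<in> borel_measurable M" "h \<in> borel_measurable M" "AE x in M. g x = h x"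
  shows "nn_Lp_norm p M g = nn_Lp_norm p M h"
  using assms by (intro antisym nn_Lp_norm_mono_AE) auto

lemma nn_Lp_norm_0: "nn_Lp_norm p M (\<lambda>x. 0) = 0"
proof (cases "p = \<infinity>")
  case True
  have "esssup M (\<lambda>x. 0) \<le> (0 :: ennreal)" by (rule esssup_I) auto
  with True show ?thesis by (simp add: nn_Lp_norm_def)
qed (simp add: nn_Lp_norm_def)

text \<open>Serves to show that the operator respects equality almost everywhere.\<close>

lemma nn_Lp_norm_eq_0_AE:
  assumes [measurable]: "g \<in> borel_measurable M" and p: "1 \<le> p" and zero: "nn_Lp_norm p M g = 0"
  shows "AE x in M. g x = 0"
  using p
proof (cases rule: exponent_ge_1_cases)
  case 1
  with zero have "esssup M g = 0" by (simp add: nn_Lp_norm_def)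
  with esssup_AE[of g M] show ?thesis by auto
next
  case (2 r)
  with zero have "(\<integral>\<^sup>+x. ennreal_powr (g x) r \<partial>M) = 0" by (simp add: nn_Lp_norm_ennreal)
  then show ?thesis by (subst (asm) nn_integral_0_iff_AE) auto
qed

text \<open>Turns a norm bound for the integral of moduli into absolute convergence at almost every
  point.\<close>

lemma nn_Lp_norm_finite_AE:
  assumes [measurable]: "g \<in> borel_measurable M" and p: "1 \<le> p" and fin: "nn_Lp_norm p M g < \<infinity>"
  shows "AE x in M. g x < \<infinity>"
  using p
proof (cases rule: exponent_ge_1_cases)
  case 1
  with fin have "esssup M g < \<infinity>" by (simp add: nn_Lp_norm_def)
  with esssup_AE[of g M] show ?thesis by (auto elim!: eventually_mono intro: le_less_trans)
next
  case (2 r)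
  with fin have "(\<integral>\<^sup>+x. ennreal_powr (g x) r \<partial>M) \<noteq> \<infinity>" by (simp add: nn_Lp_norm_ennreal less_top)
  then have "AE x in M. ennreal_powr (g x) r \<noteq> \<infinity>" by (intro nn_integral_noteq_infinite) auto
  then show ?thesis by (simp add: less_top)
qed

lemma nn_Lp_norm_multc:
  assumes [measurable]: "g \<in> borel_measurable M" and p: "1 \<le> p" "p < \<infinity>"
  shows "nn_Lp_norm p M (\<lambda>x. g x * c) = nn_Lp_norm p M g * c"
  using p(1)
proof (cases rule: exponent_ge_1_cases)
  case (2 r)
  then show ?thesis
    by (simp add: nn_Lp_norm_ennreal ennreal_powr_mult nn_integral_multc ennreal_powr_inverse_cancel)
qed (use p in auto)

lemma mixed_exponent_ennreal:
  assumes "1 \<le> a" "a < b"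
  shows "ennreal a * mixed_exponent (ennreal a) (ennreal b) = ennreal (a * (b / (b - a)))"
  using assms by (simp add: mixed_exponent_def ennreal_minus divide_ennreal flip: ennreal_mult')

text \<open>For \<open>p < q\<close>, Hoelder's inequality is applied to the p-th powers with the
  conjugate exponents q/(q - p) and q/p. For \<open>p = q\<close> the first norm is an essential
  supremum and is pulled out as a constant.\<close>

lemma nn_Lp_norm_Hoelder:
  assumes p: "1 \<le> p" "p \<le> q" "q < \<infinity>"
    and [measurable]: "g \<in> borel_measurable M" "h \<in> borel_measurable M"
  shows "nn_Lp_norm p M (\<lambda>x. g x * h x) \<le> nn_Lp_norm (p * mixed_exponent p q) M g * nn_Lp_norm q M h"
proof (cases "p = q")
  case True
  have "AE x in M. g x * h x \<le> h x * esssup M g"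
    using esssup_AE[of g M] by eventually_elim (metis mult.commute mult_right_mono zero_le)
  then have "nn_Lp_norm p M (\<lambda>x. g x * h x) \<le> nn_Lp_norm p M (\<lambda>x. h x * esssup M g)"
    by (intro nn_Lp_norm_mono_AE) measurable
  also have "\<dots> = nn_Lp_norm p M h * esssup M g"
    using p by (intro nn_Lp_norm_multc) auto
  finally show ?thesis using True p
    by (auto simp: mixed_exponent_def ennreal_mult_top nn_Lp_norm_top mult.commute[of _ top]
        mult.commute[of _ "esssup M g"])
next
  case False
  obtain a b where ab: "p = ennreal a" "q = ennreal b" "1 \<le> a" "a < b"
    using p False by (cases p; cases q) (auto simp: ennreal_le_iff2 top_unique)
  define r where "r = b / (b - a)"
  have r: "1 < r" "1 < b / a" "1 / r + 1 / (b / a) = 1"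
    using ab by (auto simp: r_def field_simps)
  have "nn_Lp_norm p M (\<lambda>x. g x * h x)
      = ennreal_powr (\<integral>\<^sup>+x. ennreal_powr (g x) a * ennreal_powr (h x) a \<partial>M) (1 / a)"
    using ab by (simp add: nn_Lp_norm_ennreal ennreal_powr_mult)
  also have "\<dots> \<le> ennreal_powr (ennreal_powr (\<integral>\<^sup>+x. ennreal_powr (ennreal_powr (g x) a) r \<partial>M) (1 / r)
      * ennreal_powr (\<integral>\<^sup>+x. ennreal_powr (ennreal_powr (h x) a) (b / a) \<partial>M) (1 / (b / a))) (1 / a)"
    using ab by (intro ennreal_powr_mono nn_integral_Hoelder r) auto
  also have "\<dots> = nn_Lp_norm (ennreal (a * r)) M g * nn_Lp_norm q M h"
    using ab r by (simp add: nn_Lp_norm_ennreal ennreal_powr_mult ennreal_powr_powr mult.commute)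
  also have "ennreal (a * r) = p * mixed_exponent p q"
    using mixed_exponent_ennreal[of a b] ab by (simp add: r_def)
  finally show ?thesis .
qed

text \<open>The function \<open>w\<close> may be non-measurable, in which case its integral is a lower integral.\<close>

lemma nn_integral_le_multc:
  assumes [measurable]: "h \<in> borel_measurable M" and c: "c < \<infinity>"
    and le: "\<And>u. u \<in> space M \<Longrightarrow> h u \<le> w u * c"
  shows "(\<integral>\<^sup>+u. h u \<partial>M) \<le> (\<integral>\<^sup>+u. w u \<partial>M) * c"
proof (cases "c = 0")
  case True
  then have "(\<integral>\<^sup>+u. h u \<partial>M) = (\<integral>\<^sup>+u. 0 \<partial>M)" using le by (intro nn_integral_cong) auto
  then show ?thesis by simp
next
  case False
  \<comment> \<open>The constant is divided out on the side of \<open>h\<close>, because extracting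
    it from the integral uses measurability of the integrand.\<close>
  then have c': "inverse c * c = 1" using c by (subst mult.commute) (simp add: ennreal_mult_inverse_self)
  have "(\<integral>\<^sup>+u. h u \<partial>M) = (\<integral>\<^sup>+u. (h u * inverse c) * c \<partial>M)" by (simp add: mult.assoc c')
  also have "\<dots> = (\<integral>\<^sup>+u. h u * inverse c \<partial>M) * c" by (intro nn_integral_multc) measurable
  also have "\<dots> \<le> (\<integral>\<^sup>+u. w u \<partial>M) * c"
  proof (intro mult_right_mono nn_integral_mono)
    fix u assume "u \<in> space M"
    from mult_right_mono[OF le[OF this], of "inverse c"]
    have "h u * inverse c \<le> w u * (inverse c * c)" by (simp add: ac_simps)
    then show "h u * inverse c \<le> w u" by (simp add: c')
  qed simp
  finally show ?thesis .
qed

section \<open>Estimates for a single parameter \<open>u\<close>\<close>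

lemma agrees_weakly_map:
  assumes "agrees_weakly M N N' A m" "A u \<in> space N \<rightarrow> space N'" "u \<in> space M"
  shows "weakly_bounded_map N N' (ennreal (inverse (m u))) (A u)"
  using assms by (auto simp: agrees_weakly_def weakly_bounded_map_def)

text \<open>The composition bound is applied to |f|^q, and the q-th root turns the factor
  \<open>inverse c\<close> into c^(-1/q). Measurability of the modulus of the composition is
  recovered from that of its q-th power by taking roots.\<close>

lemma nn_Lp_norm_comp_weak:
  fixes f :: "'t \<Rightarrow> complex"
  assumes T: "weakly_bounded_map N N' (ennreal (inverse c)) T" and c: "0 < c"
    and q: "1 \<le> q" "q < \<infinity>" and f: "f \<in> Lp_fun q N'"
  shows "(\<lambda>x. ennreal (norm (f (T x)))) \<in> borel_measurable N"
    and "nn_Lp_norm q N (\<lambda>x. ennreal (norm (f (T x))))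
      \<le> ennreal (c powr (- 1 / enn2real q)) * eLp_norm q N' f"
proof -
  obtain r where r: "q = ennreal r" "1 \<le> r"
    using q by (auto elim: exponent_ge_1_cases)
  have [measurable]: "f \<in> borel_measurable N'" and fin: "eLp_norm q N' f < \<infinity>"
    using f by (auto simp: Lp_fun_def)
  define g where "g y = ennreal_powr (ennreal (norm (f y))) r" for y
  have g: "g \<in> borel_measurable N'" unfolding g_def by measurable
  have norm: "eLp_norm q N' f = ennreal_powr (\<integral>\<^sup>+y. g y \<partial>N') (1 / r)"
    using r by (simp add: eLp_norm_eq nn_Lp_norm_ennreal g_def)
  have "(\<integral>\<^sup>+y. g y \<partial>N') < \<infinity>" using fin by (simp add: norm)
  note comp = nn_integral_comp_weak[OF T g this]
  show "(\<lambda>x. ennreal (norm (f (T x)))) \<in> borel_measurable N"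
    using comp(1) r unfolding g_def by (subst (asm) ennreal_powr_measurable_iff) auto
  have "nn_Lp_norm q N (\<lambda>x. ennreal (norm (f (T x)))) = ennreal_powr (\<integral>\<^sup>+x. g (T x) \<partial>N) (1 / r)"
    using r by (simp add: nn_Lp_norm_ennreal g_def)
  also have "\<dots> \<le> ennreal_powr (ennreal (inverse c) * (\<integral>\<^sup>+y. g y \<partial>N')) (1 / r)"
    using comp(2) r by (intro ennreal_powr_mono) auto
  also have "\<dots> = ennreal (inverse c powr (1 / r)) * eLp_norm q N' f"
    using c unfolding norm by (simp add: ennreal_powr_mult)
  also have "inverse c powr (1 / r) = c powr (- 1 / enn2real q)"
    using c r by (simp add: powr_minus powr_divide inverse_eq_divide)
  finally show "nn_Lp_norm q N (\<lambda>x. ennreal (norm (f (T x))))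
      \<le> ennreal (c powr (- 1 / enn2real q)) * eLp_norm q N' f" .
qed

lemma (in pair_sigma_finite) nn_Lp_norm_Minkowski:
  fixes F :: "'a \<Rightarrow> 'b \<Rightarrow> ennreal"
  assumes "1 \<le> p" "p < \<infinity>"
    and "(\<lambda>(u, x). F u x) \<in> borel_measurable (M1 \<Otimes>\<^sub>M M2)"
  shows "nn_Lp_norm p M2 (\<lambda>x. \<integral>\<^sup>+u. F u x \<partial>M1) \<le> (\<integral>\<^sup>+u. nn_Lp_norm p M2 (F u) \<partial>M1)"
  using assms(1)
proof (cases rule: exponent_ge_1_cases)
  case (2 r)
  then show ?thesis using nn_integral_Minkowski[OF 2(2) assms(3)] by (simp add: nn_Lp_norm_ennreal)
qed (use assms in auto)

lemma (in sigma_finite_measure) nn_Lp_norm_measurable: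
  fixes F :: "'b \<Rightarrow> 'a \<Rightarrow> ennreal"
  assumes "p < \<infinity>" and [measurable]: "(\<lambda>(u, x). F u x) \<in> borel_measurable (N \<Otimes>\<^sub>M M)"
  shows "(\<lambda>u. nn_Lp_norm p M (F u)) \<in> borel_measurable N"
  using assms(1) by (cases "p = \<infinity>") (simp_all add: nn_Lp_norm_def)

text \<open>The factor in front of the norm of \<open>f\<close> is the integrand of
  \<open>mixed_norm\<close> for finite \<open>p\<close>, so integration over \<open>u\<close>
  produces the mixed norm itself.\<close>

lemma nn_Lp_norm_slice:
  fixes \<Phi> :: "'s \<Rightarrow> complex" and f :: "'t \<Rightarrow> complex"
  assumes T: "weakly_bounded_map N N' (ennreal (inverse c)) T" and c: "0 < c"
    and p: "1 \<le> p" "p < \<infinity>" "p \<le> q" and f: "f \<in> Lp_fun q N'"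
    and [measurable]: "\<Phi> \<in> borel_measurable N" "(\<lambda>x. \<Phi> x * f (T x)) \<in> borel_measurable N"
  shows "nn_Lp_norm p N (\<lambda>x. ennreal (norm (\<Phi> x * f (T x))))
    \<le> (if q < \<infinity> then eLp_norm (p * mixed_exponent p q) N \<Phi> * ennreal (c powr (- 1 / enn2real q))
       else eLp_norm p N \<Phi>) * eLp_norm q N' f"
proof (cases "q = \<infinity>")
  case False
  then have q: "1 \<le> q" "q < \<infinity>" using p by (auto simp: less_top)
  note comp = nn_Lp_norm_comp_weak[OF T c q f]
  have "nn_Lp_norm p N (\<lambda>x. ennreal (norm (\<Phi> x * f (T x))))
    = nn_Lp_norm p N (\<lambda>x. ennreal (norm (\<Phi> x)) * ennreal (norm (f (T x))))"
    by (simp add: norm_mult ennreal_mult)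
  also have "\<dots> \<le> eLp_norm (p * mixed_exponent p q) N \<Phi> * nn_Lp_norm q N (\<lambda>x. ennreal (norm (f (T x))))"
    unfolding eLp_norm_eq using p q comp(1) by (intro nn_Lp_norm_Hoelder) auto
  also have "\<dots> \<le> eLp_norm (p * mixed_exponent p q) N \<Phi> *
      (ennreal (c powr (- 1 / enn2real q)) * eLp_norm q N' f)"
    by (intro mult_left_mono comp(2) zero_le)
  finally show ?thesis using q by (simp add: mult.assoc)
next
  case True
  have "AE y in N'. ennreal (norm (f y)) \<le> eLp_norm q N' f"
    using True esssup_AE[of "\<lambda>y. ennreal (norm (f y))" N'] by (simp add: eLp_norm_def)
  from AE_comp_weak[OF T this]
  have "AE x in N. ennreal (norm (\<Phi> x * f (T x))) \<le> ennreal (norm (\<Phi> x)) * eLp_norm q N' f"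
    by eventually_elim (simp add: norm_mult ennreal_mult mult_left_mono)
  then have "nn_Lp_norm p N (\<lambda>x. ennreal (norm (\<Phi> x * f (T x))))
      \<le> nn_Lp_norm p N (\<lambda>x. ennreal (norm (\<Phi> x)) * eLp_norm q N' f)"
    by (intro nn_Lp_norm_mono_AE) measurable
  also have "\<dots> = eLp_norm p N \<Phi> * eLp_norm q N' f"
    unfolding eLp_norm_eq[of p] using p by (intro nn_Lp_norm_multc) auto
  finally show ?thesis using True by simp
qed

section \<open>The norm estimate over a sigma-finite parameter space\<close>

text \<open>Sigma-finiteness of both measures makes Minkowski's inequality and Fubini available. The
  bound is on the integral of moduli and so presupposes no convergence. For
  \<open>p = q = \<infinity>\<close>, a pointwise bound under the integral takes the place of
  Minkowski's inequality.\<close>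

lemma nn_Lp_norm_hausdorff_sigma_finite:
  fixes \<Phi> :: "'u \<Rightarrow> 's \<Rightarrow> complex" and f :: "'t \<Rightarrow> complex"
  assumes M: "sigma_finite_measure M" and N: "sigma_finite_measure N"
    and maps: "\<And>u. u \<in> space M \<Longrightarrow> A u \<in> space N \<rightarrow> space N'"
    and \<Phi> [measurable]: "(\<lambda>(u, x). \<Phi> u x) \<in> borel_measurable (M \<Otimes>\<^sub>M N)"
    and exponents: "(1 \<le> p \<and> p \<le> q \<and> q < \<infinity>) \<or> (1 \<le> p \<and> p < q \<and> q = \<infinity>) \<or> (p = \<infinity> \<and> q = \<infinity>)"
    and agrees: "agrees_weakly M N N' A m"
    and f: "f \<in> Lp_fun q N'"
    and F [measurable]: "(\<lambda>(u, x). \<Phi> u x * f (A u x)) \<in> borel_measurable (M \<Otimes>\<^sub>M N)"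
  shows "nn_Lp_norm p N (\<lambda>x. \<integral>\<^sup>+u. ennreal (norm (\<Phi> u x * f (A u x))) \<partial>M)
    \<le> mixed_norm p q M N m \<Phi> * eLp_norm q N' f"
proof -
  interpret N: sigma_finite_measure N by fact
  interpret M: sigma_finite_measure M by fact
  interpret pair_sigma_finite M N ..
  have fin: "eLp_norm q N' f < \<infinity>" using f by (simp add: Lp_fun_def)
  have [measurable]: "(\<lambda>(x, u). \<Phi> u x) \<in> borel_measurable (N \<Otimes>\<^sub>M M)"
    "(\<lambda>(x, u). \<Phi> u x * f (A u x)) \<in> borel_measurable (N \<Otimes>\<^sub>M M)"
    by (subst measurable_pair_swap_iff, simp)+
  show ?thesis
  proof (cases "p = \<infinity>")
    case False
    then have p: "1 \<le> p" "p < \<infinity>" "p \<le> q" using exponents by (auto simp: less_top)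
    have "nn_Lp_norm p N (\<lambda>x. \<integral>\<^sup>+u. ennreal (norm (\<Phi> u x * f (A u x))) \<partial>M)
      \<le> (\<integral>\<^sup>+u. nn_Lp_norm p N (\<lambda>x. ennreal (norm (\<Phi> u x * f (A u x)))) \<partial>M)"
      using p by (intro nn_Lp_norm_Minkowski) auto
    also have "\<dots> \<le> (\<integral>\<^sup>+u. (if q < \<infinity>
        then eLp_norm (p * mixed_exponent p q) N (\<Phi> u) * ennreal (m u powr (- 1 / enn2real q))
        else eLp_norm p N (\<Phi> u)) \<partial>M) * eLp_norm q N' f"
    \<comment> \<open>For \<open>p = q\<close> the bounding function contains an essential supremum
      over \<open>x\<close>; only the slice norms on the left have to be shown measurable in
      \<open>u\<close>.\<close>
    proof (rule nn_integral_le_multc[OF _ fin])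
      show "(\<lambda>u. nn_Lp_norm p N (\<lambda>x. ennreal (norm (\<Phi> u x * f (A u x))))) \<in> borel_measurable M"
        using p by (intro N.nn_Lp_norm_measurable) auto
    next
      fix u assume u [measurable]: "u \<in> space M"
      show "nn_Lp_norm p N (\<lambda>x. ennreal (norm (\<Phi> u x * f (A u x)))) \<le> (if q < \<infinity>
        then eLp_norm (p * mixed_exponent p q) N (\<Phi> u) * ennreal (m u powr (- 1 / enn2real q))
        else eLp_norm p N (\<Phi> u)) * eLp_norm q N' f"
      proof (rule nn_Lp_norm_slice[OF agrees_weakly_map[OF agrees maps[OF u] u] _ p f])
        show "0 < m u" using agrees u by (auto simp: agrees_weakly_def)
        show "\<Phi> u \<in> borel_measurable N" "(\<lambda>x. \<Phi> u x * f (A u x)) \<in> borel_measurable N"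
          using measurable_Pair2[OF \<Phi> u] measurable_Pair2[OF F u] by simp_all
      qed
    qed
    also have "\<dots> = mixed_norm p q M N m \<Phi> * eLp_norm q N' f"
      using p by (simp add: mixed_norm_def)
    finally show ?thesis .
  next
    case True
    with exponents have q: "q = \<infinity>" by auto
    define e where "e = eLp_norm q N' f"
    define H where "H x = (\<integral>\<^sup>+u. ennreal (norm (\<Phi> u x)) \<partial>M)" for x
    have "AE u in M. AE x in N. ennreal (norm (\<Phi> u x * f (A u x))) \<le> ennreal (norm (\<Phi> u x)) * e"
    proof (rule AE_I2)
      fix u assume u: "u \<in> space M"
      have "AE y in N'. ennreal (norm (f y)) \<le> e"
        using q esssup_AE[of "\<lambda>y. ennreal (norm (f y))" N'] by (simp add: eLp_norm_def e_def)
      from AE_comp_weak[OF agrees_weakly_map[OF agrees maps[OF u] u] this]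
      show "AE x in N. ennreal (norm (\<Phi> u x * f (A u x))) \<le> ennreal (norm (\<Phi> u x)) * e"
        by eventually_elim (simp add: norm_mult ennreal_mult mult_left_mono)
    qed
    \<comment> \<open>The null set of bad \<open>x\<close> varies with \<open>u\<close>; exchanging
      the quantifiers allows integration over \<open>u\<close> at a fixed \<open>x\<close>.\<close>
    then have "AE x in N. AE u in M. ennreal (norm (\<Phi> u x * f (A u x))) \<le> ennreal (norm (\<Phi> u x)) * e"
      by (subst (asm) AE_commute) measurable
    then have "AE x in N. (\<integral>\<^sup>+u. ennreal (norm (\<Phi> u x * f (A u x))) \<partial>M) \<le> esssup N H * e"
      using esssup_AE[of H N] AE_space
    proof eventually_elim
      case (elim x)
      note [measurable] = elim(3)
      have "(\<integral>\<^sup>+u. ennreal (norm (\<Phi> u x * f (A u x))) \<partial>M) \<le> (\<integral>\<^sup>+u. ennreal (norm (\<Phi> u x)) * e \<partial>M)"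
        using elim(1) by (rule nn_integral_mono_AE)
      also have "\<dots> = H x * e" unfolding H_def by (intro nn_integral_multc) measurable
      also have "\<dots> \<le> esssup N H * e" using elim(2) by (rule mult_right_mono) simp
      finally show ?case .
    qed
    then have "esssup N (\<lambda>x. \<integral>\<^sup>+u. ennreal (norm (\<Phi> u x * f (A u x))) \<partial>M) \<le> esssup N H * e"
      by (intro esssup_I) measurable
    then show ?thesis using True q
      by (simp add: nn_Lp_norm_def mixed_norm_def e_def H_def[abs_def])
  qed
qed

section \<open>Restriction of the parameter space to a set carrying the kernel\<close>

lemma nn_integral_restrict_support:
  assumes "\<Omega> \<in> sets M" "\<And>u. u \<in> space M - \<Omega> \<Longrightarrow> g u = 0"
  shows "(\<integral>\<^sup>+u. g u \<partial>restrict_space M \<Omega>) = (\<integral>\<^sup>+u. g u \<partial>M)"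
proof -
  have "(\<integral>\<^sup>+u. g u \<partial>restrict_space M \<Omega>) = (\<integral>\<^sup>+u. g u * indicator \<Omega> u \<partial>M)"
    using assms(1) by (intro nn_integral_restrict_space) auto
  also have "\<dots> = (\<integral>\<^sup>+u. g u \<partial>M)"
    using assms(2) by (intro nn_integral_cong) (auto simp: indicator_def)
  finally show ?thesis .
qed

lemma integral_restrict_support:
  fixes g :: "'a \<Rightarrow> 'b::{banach, second_countable_topology}"
  assumes "\<Omega> \<in> sets M" "\<And>u. u \<in> space M - \<Omega> \<Longrightarrow> g u = 0"
  shows "(\<integral>u. g u \<partial>restrict_space M \<Omega>) = (\<integral>u. g u \<partial>M)"
proof -
  have "(\<integral>u. g u \<partial>restrict_space M \<Omega>) = (\<integral>u. indicator \<Omega> u *\<^sub>R g u \<partial>M)"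
    using assms(1) by (intro integral_restrict_space) auto
  also have "\<dots> = (\<integral>u. g u \<partial>M)"
    using assms(2) by (intro Bochner_Integration.integral_cong) (auto simp: indicator_def)
  finally show ?thesis .
qed

lemma measurable_pair_restrict_space1:
  assumes [measurable]: "F \<in> M \<Otimes>\<^sub>M N \<rightarrow>\<^sub>M L"
  shows "F \<in> restrict_space M \<Omega> \<Otimes>\<^sub>M N \<rightarrow>\<^sub>M L"
proof -
  have [measurable]: "(\<lambda>u. u) \<in> restrict_space M \<Omega> \<rightarrow>\<^sub>M M"
    by (rule measurable_restrict_space1) simp
  have "(\<lambda>z. F (fst z, snd z)) \<in> restrict_space M \<Omega> \<Otimes>\<^sub>M N \<rightarrow>\<^sub>M L"
    using measurable_compose[OF measurable_fst, of "\<lambda>u. u" "restrict_space M \<Omega>" M N] by measurable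
  then show ?thesis by simp
qed

lemma agrees_weakly_restrict:
  assumes "agrees_weakly M N N' A m"
  shows "agrees_weakly (restrict_space M \<Omega>) N N' A m"
  using assms by (auto simp: agrees_weakly_def space_restrict_space intro: measurable_restrict_space1)

lemma eLp_norm_eq_0:
  assumes "\<And>x. x \<in> space M \<Longrightarrow> f x = 0"
  shows "eLp_norm p M f = 0"
proof -
  have "(\<lambda>x. ennreal (norm (f x))) \<in> borel_measurable M"
    using assms by (subst measurable_cong[where g = "\<lambda>x. 0"]) auto
  then have "eLp_norm p M f = nn_Lp_norm p M (\<lambda>x. 0)"
    unfolding eLp_norm_eq using assms by (intro nn_Lp_norm_cong_AE) auto
  then show ?thesis by (simp add: nn_Lp_norm_0)
qed

text \<open>For \<open>u\<close> outside \<open>\<Omega>\<close> the slice \<open>\<Phi> u\<close>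
  vanishes on \<open>space N\<close>, so its norms are 0 and the outer integral sees only
  \<open>\<Omega>\<close>. For \<open>p = q = \<infinity>\<close> the inner integral is unchanged at
  every point of \<open>space N\<close>.\<close>

lemma mixed_norm_restrict_support:
  assumes \<Omega>: "\<Omega> \<in> sets M" and sf: "sigma_finite_measure (restrict_space M \<Omega>)"
    and zero: "\<And>u x. u \<in> space M - \<Omega> \<Longrightarrow> x \<in> space N \<Longrightarrow> \<Phi> u x = 0"
    and \<Phi>: "(\<lambda>(u, x). \<Phi> u x) \<in> borel_measurable (M \<Otimes>\<^sub>M N)"
  shows "mixed_norm p q (restrict_space M \<Omega>) N m \<Phi> = mixed_norm p q M N m \<Phi>"
proof -
  interpret R: sigma_finite_measure "restrict_space M \<Omega>" by fact
  have [measurable]: "(\<lambda>(x, u). \<Phi> u x) \<in> borel_measurable (N \<Otimes>\<^sub>M restrict_space M \<Omega>)"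
    using measurable_pair_restrict_space1[OF \<Phi>] by (subst measurable_pair_swap_iff) simp
  have 0: "eLp_norm s N (\<Phi> u) = 0" if "u \<in> space M - \<Omega>" for u s
    using zero[OF that] by (rule eLp_norm_eq_0)
  have eq: "(\<integral>\<^sup>+u. ennreal (norm (\<Phi> u x)) \<partial>restrict_space M \<Omega>) = (\<integral>\<^sup>+u. ennreal (norm (\<Phi> u x)) \<partial>M)"
    if "x \<in> space N" for x
    using zero that by (intro nn_integral_restrict_support[OF \<Omega>]) simp
  have meas: "(\<lambda>x. \<integral>\<^sup>+u. ennreal (norm (\<Phi> u x)) \<partial>restrict_space M \<Omega>) \<in> borel_measurable N"
    by measurable
  \<comment> \<open>Both functions of \<open>x\<close> must be measurable: Tonelli gives this over
    the sigma-finite restriction, and equality on \<open>space N\<close> carries it over to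
    \<open>M\<close>.\<close>
  have "esssup N (\<lambda>x. \<integral>\<^sup>+u. ennreal (norm (\<Phi> u x)) \<partial>restrict_space M \<Omega>)
      = esssup N (\<lambda>x. \<integral>\<^sup>+u. ennreal (norm (\<Phi> u x)) \<partial>M)"
    using meas meas[THEN measurable_cong[THEN iffD1, rotated], OF eq] eq by (intro esssup_AE_cong) auto
  moreover have restrict: "(\<integral>\<^sup>+u. eLp_norm s N (\<Phi> u) * w u \<partial>restrict_space M \<Omega>)
      = (\<integral>\<^sup>+u. eLp_norm s N (\<Phi> u) * w u \<partial>M)" for s w
    using 0 by (intro nn_integral_restrict_support[OF \<Omega>]) simp
  \<comment> \<open>The constant weight 1 covers the case of finite \<open>p\<close> and
    \<open>q = \<infinity>\<close>.\<close>
  moreover note restrict[of p "\<lambda>u. 1"]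
  ultimately show ?thesis by (simp add: mixed_norm_def)
qed

section \<open>Boundedness and norm of the Hausdorff operator\<close>

text \<open>\<open>agrees_weakly\<close> controls each \<open>A u\<close> separately, so joint
  measurability of the integrand is a hypothesis of its own. The sigma-finite set carrying
  \<open>\<Phi>\<close> makes Fubini applicable. Integrability almost everywhere is a separate
  conclusion because a divergent Bochner integral has the default value 0.\<close>

theorem theorem4:
  fixes M :: "'u measure" and N :: "'s measure" and N' :: "'t measure"
    and A :: "'u \<Rightarrow> 's \<Rightarrow> 't" and \<Phi> :: "'u \<Rightarrow> 's \<Rightarrow> complex"
    and m :: "'u \<Rightarrow> real" and p q :: ennreal
  assumes maps: "\<And>u. u \<in> space M \<Longrightarrow> A u \<in> space N \<rightarrow> space N'"
    and \<Phi>_measurable: "(\<lambda>(u, x). \<Phi> u x) \<in> borel_measurable (M \<Otimes>\<^sub>M N)"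
    and \<Phi>_support: "\<exists>\<Omega>\<in>sets M. sigma_finite_measure (restrict_space M \<Omega>) \<and>
           (\<forall>u\<in>space M - \<Omega>. \<forall>x\<in>space N. \<Phi> u x = 0)"
    and exponents: "(1 \<le> p \<and> p \<le> q \<and> q < \<infinity>) \<or> (1 \<le> p \<and> p < q \<and> q = \<infinity>) \<or> (p = \<infinity> \<and> q = \<infinity>)"
    and sigma_finite_N: "sigma_finite_measure N"
    and agrees: "agrees_weakly M N N' A m"
    and integrand_measurable: "\<And>f. f \<in> Lp_fun q N' \<Longrightarrow>
           (\<lambda>(u, x). \<Phi> u x * f (A u x)) \<in> borel_measurable (M \<Otimes>\<^sub>M N)"
    and norm_finite: "mixed_norm p q M N m \<Phi> < \<infinity>"
  shows "(\<forall>f\<in>Lp_fun q N'. AE x in N. integrable M (\<lambda>u. \<Phi> u x * f (A u x))) \<and>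
         bounded_Lp_operator q N' p N (hausdorff_op \<Phi> A M) \<and>
         Lp_operator_norm q N' p N (hausdorff_op \<Phi> A M) \<le> mixed_norm p q M N m \<Phi>"
proof -
  obtain \<Omega> where \<Omega>: "\<Omega> \<in> sets M" "sigma_finite_measure (restrict_space M \<Omega>)"
    and zero: "\<And>u x. u \<in> space M - \<Omega> \<Longrightarrow> x \<in> space N \<Longrightarrow> \<Phi> u x = 0"
    using \<Phi>_support by blast
  interpret R: sigma_finite_measure "restrict_space M \<Omega>" by fact
  let ?T = "hausdorff_op \<Phi> A M" and ?K = "mixed_norm p q M N m \<Phi>"
  have p: "1 \<le> p" using exponents by auto
  \<comment> \<open>\<open>G f\<close> majorises the modulus of the operator wherever the integral
    converges. Its measurability in \<open>x\<close> comes from Tonelli over the sigma-finite set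
    \<open>\<Omega>\<close>.\<close>
  define G where "G f x = (\<integral>\<^sup>+u. ennreal (norm (\<Phi> u x * f (A u x))) \<partial>M)" for f x
  have F_restrict [measurable]:
    "(\<lambda>(x, u). \<Phi> u x * f (A u x)) \<in> borel_measurable (N \<Otimes>\<^sub>M restrict_space M \<Omega>)"
    if "f \<in> Lp_fun q N'" for f
    using measurable_pair_restrict_space1[OF integrand_measurable[OF that]]
    by (subst measurable_pair_swap_iff) simp
  have G_restrict: "G f x = (\<integral>\<^sup>+u. ennreal (norm (\<Phi> u x * f (A u x))) \<partial>restrict_space M \<Omega>)"
    if "x \<in> space N" for f x
    unfolding G_def using zero that by (intro nn_integral_restrict_support[OF \<Omega>(1), symmetric]) simp
  have G_measurable: "G f \<in> borel_measurable N" if f: "f \<in> Lp_fun q N'" for f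
  proof -
    note [measurable] = F_restrict[OF f]
    show ?thesis by (subst measurable_cong[OF G_restrict]) measurable
  qed
  have G_le: "nn_Lp_norm p N (G f) \<le> ?K * eLp_norm q N' f" if f: "f \<in> Lp_fun q N'" for f
  proof -
    note [measurable] = F_restrict[OF f]
    have "nn_Lp_norm p N (G f)
      = nn_Lp_norm p N (\<lambda>x. \<integral>\<^sup>+u. ennreal (norm (\<Phi> u x * f (A u x))) \<partial>restrict_space M \<Omega>)"
      by (intro nn_Lp_norm_cong_AE AE_I2 G_restrict G_measurable[OF f]) simp_all
    also have "\<dots> \<le> mixed_norm p q (restrict_space M \<Omega>) N m \<Phi> * eLp_norm q N' f"
      using maps
      by (intro nn_Lp_norm_hausdorff_sigma_finite[OF \<Omega>(2) sigma_finite_N] exponents f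
          agrees_weakly_restrict[OF agrees] measurable_pair_restrict_space1
          \<Phi>_measurable integrand_measurable) (auto simp: space_restrict_space)
    also have "mixed_norm p q (restrict_space M \<Omega>) N m \<Phi> = ?K"
      using \<Omega> zero \<Phi>_measurable by (rule mixed_norm_restrict_support)
    finally show ?thesis .
  qed
  have T_measurable: "?T f \<in> borel_measurable N" if f: "f \<in> Lp_fun q N'" for f
  proof -
    note [measurable] = F_restrict[OF f]
    have "?T f x = (\<integral>u. \<Phi> u x * f (A u x) \<partial>restrict_space M \<Omega>)" if "x \<in> space N" for x
      unfolding hausdorff_op_def
      using zero that by (intro integral_restrict_support[OF \<Omega>(1), symmetric]) simp
    then show ?thesis by (subst measurable_cong) measurable
  qed
  have integrable: "AE x in N. integrable M (\<lambda>u. \<Phi> u x * f (A u x))" if f: "f \<in> Lp_fun q N'" for f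
  proof -
    have "?K * eLp_norm q N' f < \<infinity>"
      using f norm_finite by (simp add: Lp_fun_def ennreal_mult_less_top)
    with G_le[OF f] have "nn_Lp_norm p N (G f) < \<infinity>" by (rule le_less_trans)
    with G_measurable[OF f] p have "AE x in N. G f x < \<infinity>" by (rule nn_Lp_norm_finite_AE)
    then show ?thesis using AE_space
    proof eventually_elim
      case (elim x)
      note [measurable] = integrand_measurable[OF f] elim(2)
      have "(\<lambda>u. \<Phi> u x * f (A u x)) \<in> borel_measurable M" by measurable
      with elim show ?case by (simp add: integrable_iff_bounded G_def)
    qed
  qed
  have T_le_G: "ennreal (norm (?T f x)) \<le> G f x" if "integrable M (\<lambda>u. \<Phi> u x * f (A u x))" for f x
    unfolding hausdorff_op_def G_def using that by (rule integral_norm_bound_ennreal)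
  have T_le: "eLp_norm p N (?T f) \<le> ?K * eLp_norm q N' f" if f: "f \<in> Lp_fun q N'" for f
  proof -
    note [measurable] = T_measurable[OF f]
    have "AE x in N. ennreal (norm (?T f x)) \<le> G f x"
      using integrable[OF f] by eventually_elim (rule T_le_G)
    then have "eLp_norm p N (?T f) \<le> nn_Lp_norm p N (G f)"
      unfolding eLp_norm_eq by (intro nn_Lp_norm_mono_AE) measurable
    also note G_le[OF f]
    finally show ?thesis .
  qed
  have T_Lp: "?T f \<in> Lp_fun p N" if f: "f \<in> Lp_fun q N'" for f
  proof -
    have "?K * eLp_norm q N' f < \<infinity>"
      using f norm_finite by (simp add: Lp_fun_def ennreal_mult_less_top)
    with T_le[OF f] T_measurable[OF f] show ?thesis
      by (auto simp: Lp_fun_def intro: le_less_trans)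
  qed
  \<comment> \<open>Additivity can fail where an integrand is not integrable and its integral takes
    the default value 0; such points form a null set.\<close>
  have T_add: "AE x in N. ?T (\<lambda>y. f y + g y) x = ?T f x + ?T g x"
    if "f \<in> Lp_fun q N'" "g \<in> Lp_fun q N'" for f g
    using integrable[OF that(1)] integrable[OF that(2)]
    by eventually_elim (simp add: hausdorff_op_def distrib_left)
  have T_cong: "AE x in N. ?T f x = ?T g x"
    if f: "f \<in> Lp_fun q N'" and g: "g \<in> Lp_fun q N'" and fg: "AE y in N'. f y = g y" for f g
  proof -
    \<comment> \<open>The norm bound applied to \<open>f - g\<close>, which has norm 0, replaces another use of Fubini.\<close>
    define h where "h y = f y - g y" for y
    have [measurable]: "f \<in> borel_measurable N'" "g \<in> borel_measurable N'"
      using f g by (auto simp: Lp_fun_def)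
    have h_meas [measurable]: "h \<in> borel_measurable N'" unfolding h_def by measurable
    have "eLp_norm q N' h = nn_Lp_norm q N' (\<lambda>y. 0)"
      unfolding eLp_norm_eq
      by (rule nn_Lp_norm_cong_AE) (use fg in \<open>auto simp: h_def elim!: eventually_mono\<close>)
    then have h0: "eLp_norm q N' h = 0" by (simp add: nn_Lp_norm_0)
    then have h: "h \<in> Lp_fun q N'" by (simp add: Lp_fun_def)
    note [measurable] = T_measurable[OF h]
    have "nn_Lp_norm p N (\<lambda>x. ennreal (norm (?T h x))) = 0"
      using T_le[OF h] by (simp add: h0 flip: eLp_norm_eq)
    then have "AE x in N. ennreal (norm (?T h x)) = 0"
      by (intro nn_Lp_norm_eq_0_AE[OF _ p]) measurable
    moreover have "AE x in N. ?T (\<lambda>y. g y + h y) x = ?T g x + ?T h x"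
      using g h by (rule T_add)
    ultimately show ?thesis by eventually_elim (simp add: h_def)
  qed
  \<comment> \<open>Homogeneity holds at every point, since scalars can be taken out of the Bochner
    integral even where it has its default value. The bounding constant is the mixed norm.\<close>
  have "bounded_Lp_operator q N' p N ?T"
    unfolding bounded_Lp_operator_def
    using T_Lp T_cong T_add T_le norm_finite
    by (auto simp: hausdorff_op_def mult.left_commute[of _ c for c] intro!: exI[of _ ?K])
  moreover have "Lp_operator_norm q N' p N ?T \<le> ?K"
    unfolding Lp_operator_norm_def
  proof (rule SUP_least)
    fix f assume "f \<in> {f \<in> Lp_fun q N'. eLp_norm q N' f \<le> 1}"
    then have "eLp_norm p N (?T f) \<le> ?K * eLp_norm q N' f" "eLp_norm q N' f \<le> 1"
      using T_le by auto
    then show "eLp_norm p N (?T f) \<le> ?K"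
      using mult_left_mono[of "eLp_norm q N' f" 1 ?K] by (auto intro: order_trans)
  qed
  ultimately show ?thesis using integrable by blast
qed

end
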